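(* Let $F:\mathbb R^n\to\mathbb R^n$ be $\mu$-strongly monotone ($\mu>0$) and globally Lipschitz with constant $\ell_F$, and let $\mathcal C=\{x\in\mathbb R^n\mid Gx-c_g\le0,\ Hx-c_h=0\}$ be a polyhedral set, with $G\in\mathbb R^{m\times n}$, $c_g\in\mathbb R^m$, $H\in\mathbb R^{k\times n}$, $c_h\in\mathbb R^k$. If $\alpha>\frac{\ell_F^2}{4\mu}$, then the safe monotone flow $\dot x=\mathcal G_\alpha(x)$ is contracting with rate $c=\mu-\frac{\ell_F^2}{4\alpha}$. In particular, the unique solution $x^*\in\mathrm{SOL}(F,\mathcal C)$ is globally exponentially stable.
   Context: $F$ is continuously differentiable. $F$ is $\mu$-strongly monotone if $(x-y)^\top(F(x)-F(y))\ge\mu\|x-y\|^2$ for all $x,y$. $\mathrm{SOL}(F,\mathcal C)$ is the set of $x^*\in\mathcal C$ with $(x-x^* )^\top F(x^* )\ge0$ for all $x\in\mathcal C$; it is assumed nonempty. With $g(x)=Gx-c_g$, $h(x)=Hx-c_h$, the $\alpha$-restricted tangent set is $T^{(\alpha)}_{\mathcal C}(x)=\{\xi\in\mathbb R^n\mid G\xi\le-\alpha(Gx-c_g),\ H\xi=-\alpha(Hx-c_h)\}$, and the safe monotone flow is $\dot x=\mathcal G_\alpha(x):=\mathrm{proj}_{T^{(\alpha)}_{\mathcal C}(x)}(-F(x))$ (Euclidean projection). A system is contracting with rate $c>0$ (here in the Euclidean norm) if any two trajectories satisfy $\|x(t)-y(t)\|\le e^{-ct}\|x(0)-y(0)\|$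 for all $t\ge0$; for $\dot x=\mathcal G(x)$ with $\mathcal G$ continuous this is equivalent to $(x-y)^\top(\mathcal G(x)-\mathcal G(y))\le-c\|x-y\|^2$ for all $x,y$. *)

theory Defs
  imports "HOL-Analysis.Analysis"
begin

definition continuously_differentiable ::
    "('a::real_normed_vector \<Rightarrow> 'b::real_normed_vector) \<Rightarrow> bool" where
  "continuously_differentiable F \<longleftrightarrow>
     (\<exists>F' :: 'a \<Rightarrow> 'a \<Rightarrow>\<^sub>L 'b.
        (\<forall>x. (F has_derivative blinfun_apply (F' x)) (at x)) \<and> continuous_on UNIV F')"

definition strongly_monotone :: "real \<Rightarrow> ('a::real_inner \<Rightarrow> 'a) \<Rightarrow> bool" where
  "strongly_monotone \<mu> F \<longleftrightarrow> (\<forall>x y. (x - y) \<bullet> (F x - F y) \<ge> \<mu> * (norm (x - y))\<^sup>2)"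

definition SOL :: "('a::real_inner \<Rightarrow> 'a) \<Rightarrow> 'a set \<Rightarrow> 'a set" where
  "SOL F C = {xs \<in> C. \<forall>x\<in>C. (x - xs) \<bullet> F xs \<ge> 0}"

text \<open>The order on vectors is componentwise. The index types \<open>'m\<close> and \<open>'k\<close> are
  nonempty; the absence of inequality (equality) constraints corresponds to a zero matrix
  together with a zero right-hand side.\<close>

definition polyhedral_set ::
    "real^'n^'m \<Rightarrow> real^'m \<Rightarrow> real^'n^'k \<Rightarrow> real^'k \<Rightarrow> (real^'n) set" where
  "polyhedral_set G cg H ch = {x. G *v x - cg \<le> 0 \<and> H *v x - ch = 0}"

definition restricted_tangent_set ::
    "real \<Rightarrow> real^'n^'m \<Rightarrow> real^'m \<Rightarrow> real^'n^'k \<Rightarrow> real^'k \<Rightarrow> real^'n \<Rightarrow> (real^'n) set" where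
  "restricted_tangent_set \<alpha> G cg H ch x =
     {\<xi>. G *v \<xi> \<le> - (\<alpha> *\<^sub>R (G *v x - cg)) \<and> H *v \<xi> = - (\<alpha> *\<^sub>R (H *v x - ch))}"

definition safe_monotone_field ::
    "(real^'n \<Rightarrow> real^'n) \<Rightarrow> real \<Rightarrow> real^'n^'m \<Rightarrow> real^'m \<Rightarrow> real^'n^'k \<Rightarrow> real^'k
      \<Rightarrow> real^'n \<Rightarrow> real^'n" where
  "safe_monotone_field F \<alpha> G cg H ch x =
     closest_point (restricted_tangent_set \<alpha> G cg H ch x) (- F x)"

definition trajectory :: "('a::real_normed_vector \<Rightarrow> 'a) \<Rightarrow> (real \<Rightarrow> 'a) \<Rightarrow> bool" where
  "trajectory f x \<longleftrightarrow> (\<forall>t\<ge>0. (x has_vector_derivative f (x t)) (at t within {0..}))"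

definition contracting :: "('a::real_normed_vector \<Rightarrow> 'a) \<Rightarrow> real \<Rightarrow> bool" where
  "contracting f c \<longleftrightarrow> c > 0 \<and>
     (\<forall>x y. trajectory f x \<longrightarrow> trajectory f y \<longrightarrow>
        (\<forall>t\<ge>0. norm (x t - y t) \<le> exp (- c * t) * norm (x 0 - y 0)))"

text \<open>Forward completeness (existence of a trajectory on \<open>[0, \<infinity>)\<close> from every initial state)
  is part of the definition, so that the estimate cannot hold vacuously.\<close>

definition globally_exponentially_stable ::
    "('a::real_normed_vector \<Rightarrow> 'a) \<Rightarrow> 'a \<Rightarrow> bool" where
  "globally_exponentially_stable f xs \<longleftrightarrow>
     f xs = 0 \<and>
     (\<forall>x0. \<exists>x. trajectory f x \<and> x 0 = x0) \<and>
     (\<exists>M>0. \<exists>r>0. \<forall>x. trajectory f x \<longrightarrow>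
        (\<forall>t\<ge>0. norm (x t - xs) \<le> M * exp (- r * t) * norm (x 0 - xs)))"

end

theory Submission
  imports Defs
begin

text \<open>For nonempty \<open>C\<close> and \<open>\<alpha> > 0\<close> the restricted tangent set at \<open>x\<close> is the affine image
  \<open>\<alpha> (C - x)\<close>, so the safe monotone flow is the projected dynamics
  \<open>x' = \<alpha> (P (x - F x / \<alpha>) - x)\<close> with \<open>P\<close> the projection onto \<open>C\<close>. This field is globally
  Lipschitz, its zeros are the solutions of the variational inequality, and firm
  nonexpansiveness of \<open>P\<close> gives
  \<open>(x - y) \<bullet> (f x - f y) \<le> - (x - y) \<bullet> (F x - F y) + (norm (F x - F y))\<^sup>2 / (4 \<alpha>)\<close>,
  which strong monotonicity and the Lipschitz bound turn into the one-sided estimate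
  equivalent to contraction.\<close>

section \<open>Projections onto closed convex sets\<close>

text \<open>Test the obtuse-angle inequality of each projection with the other projected point and
  add.\<close>

lemma closest_point_firmly_nonexpansive:
  fixes S :: "'a::euclidean_space set"
  assumes "convex S" "closed S" "S \<noteq> {}"
  shows "(norm (closest_point S a - closest_point S b))\<^sup>2
    \<le> (closest_point S a - closest_point S b) \<bullet> (a - b)"
proof -
  let ?p = "closest_point S a" and ?q = "closest_point S b"
  have "(a - ?p) \<bullet> (?q - ?p) \<le> 0" "(b - ?q) \<bullet> (?p - ?q) \<le> 0"
    using assms by (auto intro!: closest_point_dot closest_point_in_set)
  then show ?thesis
    by (simp add: power2_norm_eq_inner inner_diff_left inner_diff_right inner_commute)
qed

text \<open>The homothety scales all distances by \<open>c\<close>, hence preserves nearest points,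
  and it sends \<open>x + y /\<^sub>R c\<close> to \<open>y\<close>.\<close>

lemma closest_point_affinity:
  fixes S :: "'a::euclidean_space set"
  assumes "convex S" "closed S" "S \<noteq> {}" and "c > 0"
  shows "closest_point ((\<lambda>z. c *\<^sub>R (z - x)) ` S) y = c *\<^sub>R (closest_point S (x + y /\<^sub>R c) - x)"
proof (rule sym, rule closest_point_unique)
  have image: "(\<lambda>z. c *\<^sub>R (z - x)) ` S = (+) (- (c *\<^sub>R x)) ` (*\<^sub>R) c ` S"
    by (auto simp: image_image algebra_simps)
  show "convex ((\<lambda>z. c *\<^sub>R (z - x)) ` S)" "closed ((\<lambda>z. c *\<^sub>R (z - x)) ` S)"
    unfolding image by (intro convex_translation convex_scaling closed_translation closed_scaling assms)+
  show "c *\<^sub>R (closest_point S (x + y /\<^sub>R c) - x) \<in> (\<lambda>z. c *\<^sub>R (z - x)) ` S"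
    using closest_point_in_set[OF assms(2,3)] by blast
  have dist: "dist y (c *\<^sub>R (z - x)) = c * dist (x + y /\<^sub>R c) z" for z
  proof -
    have "y - c *\<^sub>R (z - x) = c *\<^sub>R (x + y /\<^sub>R c - z)"
      using \<open>c > 0\<close> by (simp add: algebra_simps)
    then show ?thesis
      using \<open>c > 0\<close> by (simp add: dist_norm)
  qed
  show "\<forall>z\<in>(\<lambda>z. c *\<^sub>R (z - x)) ` S. dist y (c *\<^sub>R (closest_point S (x + y /\<^sub>R c) - x)) \<le> dist y z"
    using closest_point_le[OF assms(2)] \<open>c > 0\<close> by (auto simp: dist)
qed

section \<open>Global existence of trajectories for Lipschitz fields\<close>

lemma integral_has_vector_derivative_within_atLeast:
  fixes g :: "real \<Rightarrow> 'a::banach"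
  assumes "continuous_on {a..} g" and "a \<le> t"
  shows "((\<lambda>u. integral {a..u} g) has_vector_derivative g t) (at t within {a..})"
proof -
  have "((\<lambda>u. integral {a..u} g) has_vector_derivative g t) (at t within {a..t + 1})"
    using assms by (intro integral_has_vector_derivative continuous_on_subset[OF assms(1)]) auto
  \<comment> \<open>Differentiability is local: below \<open>t + 1\<close> the compact interval and
    the half-line coincide.\<close>
  moreover have "at t within {a..t + 1} = at t within {a..}"
    by (rule at_within_nhd[of _ "{..<t + 1}"]) auto
  ultimately show ?thesis
    by simp
qed

text \<open>The weight trades growth of order \<open>exp (K * s)\<close> for a factor
  \<open>1 / K\<close>. In the Picard iteration this gives both the contraction estimate and
  boundedness of the iterates.\<close>

lemma exp_weighted_integral_bound:
  fixes g :: "real \<Rightarrow> 'a::banach"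
  assumes "continuous_on {0..t} g" "K > 0" "0 \<le> t" "0 \<le> A"
    and "\<And>s. 0 \<le> s \<Longrightarrow> s \<le> t \<Longrightarrow> norm (g s) \<le> A * exp (K * s)"
  shows "norm (exp (- K * t) *\<^sub>R integral {0..t} g) \<le> A / K"
proof -
  have "((\<lambda>s. A * exp (K * s)) has_integral A * exp (K * t) / K - A * exp (K * 0) / K) {0..t}"
    using assms(2,3)
    by (intro fundamental_theorem_of_calculus)
       (auto intro!: derivative_eq_intros simp flip: has_real_derivative_iff_has_vector_derivative)
  then have int: "(\<lambda>s. A * exp (K * s)) integrable_on {0..t}"
      "integral {0..t} (\<lambda>s. A * exp (K * s)) = A * exp (K * t) / K - A / K"
    by (auto simp: has_integral_iff)
  have "norm (integral {0..t} g) \<le> integral {0..t} (\<lambda>s. A * exp (K * s))"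
    using assms by (intro integral_norm_bound_integral integrable_continuous_real int) auto
  also have "\<dots> \<le> A * exp (K * t) / K"
    using int assms by simp
  finally have "exp (- K * t) * norm (integral {0..t} g) \<le> exp (- K * t) * (A * exp (K * t) / K)"
    by (intro mult_left_mono) auto
  also have "\<dots> = A / K"
    by (simp add: exp_minus)
  finally show ?thesis
    by simp
qed

text \<open>Picard iteration in the norm \<open>sup exp (- K * t) * norm (x t - x0)\<close>: for \<open>K > L\<close> the
  integral operator is a contraction on the whole half-line, so no continuation argument is
  needed. Bounded continuous functions live on all of \<open>real\<close>, hence the \<open>max 0 t\<close>.\<close>

lemma lipschitz_trajectory_exists:
  fixes f :: "'a::banach \<Rightarrow> 'a"
  assumes lip: "L-lipschitz_on UNIV f"
  shows "\<exists>x. trajectory f x \<and> x 0 = x0"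
proof -
  \<comment> \<open>Any \<open>K > L\<close> yields a contraction factor \<open>L / K < 1\<close>;
    adding 1 also keeps \<open>K\<close> positive when \<open>L = 0\<close>.\<close>
  define K where "K = L + 1"
  have L: "0 \<le> L" and K: "0 < K"
    using lipschitz_on_nonneg[OF lip] by (auto simp: K_def)
  \<comment> \<open>The unknown \<open>y\<close> is the rescaled deviation from \<open>x0\<close>,
    so the weighted norm of the trajectory becomes the plain sup norm of \<open>y\<close>;
    \<open>\<Phi>\<close> is the Picard operator in this variable.\<close>
  define x where "x y s = x0 + exp (K * s) *\<^sub>R apply_bcontfun y s" for y :: "real \<Rightarrow>\<^sub>C 'a" and s
  define \<Phi> where "\<Phi> y t = exp (- K * max 0 t) *\<^sub>R integral {0..max 0 t} (\<lambda>s. f (x y s))" for y t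
  have contf: "continuous_on T (\<lambda>s. f (x y s))" for y T
    unfolding x_def
    by (intro continuous_on_compose2[OF lipschitz_on_continuous_on[OF lip]] continuous_intros) auto
  have deriv: "((\<lambda>u. integral {0..u} (\<lambda>s. f (x y s))) has_vector_derivative f (x y t)) (at t within {0..})"
    if "0 \<le> t" for y t
    using that by (intro integral_has_vector_derivative_within_atLeast contf)
  have \<Phi>_diff: "norm (\<Phi> y t - \<Phi> z t) \<le> L / K * dist y z" for y z t
  proof -
    have "norm (exp (- K * max 0 t) *\<^sub>R integral {0..max 0 t} (\<lambda>s. f (x y s) - f (x z s))) \<le> L * dist y z / K"
    proof (rule exp_weighted_integral_bound)
      fix s
      have "norm (f (x y s) - f (x z s)) \<le> L * norm (x y s - x z s)"
        by (intro lipschitz_on_normD[OF lip]) auto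
      also have "x y s - x z s = exp (K * s) *\<^sub>R (apply_bcontfun y s - apply_bcontfun z s)"
        by (simp add: x_def algebra_simps)
      also have "L * norm \<dots> \<le> L * (exp (K * s) * dist y z)"
        using dist_bounded[of y s z] L by (auto simp: dist_norm intro!: mult_left_mono)
      finally show "norm (f (x y s) - f (x z s)) \<le> L * dist y z * exp (K * s)"
        by (simp add: mult_ac)
    qed (use K L in \<open>auto intro!: continuous_intros contf\<close>)
    then show ?thesis
      by (simp add: \<Phi>_def integral_diff integrable_continuous_real contf scaleR_diff_right)
  qed
  have \<Phi>_bound: "norm (\<Phi> y t) \<le> (norm (f x0) + L * norm y) / K" for y t
    unfolding \<Phi>_def
  proof (rule exp_weighted_integral_bound)
    fix s :: real
    assume s: "0 \<le> s"
    have "norm (f (x y s)) \<le> norm (f x0) + norm (f (x y s) - f x0)"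
      by (metis add.commute diff_add_cancel norm_triangle_ineq)
    also have "norm (f (x y s) - f x0) \<le> L * norm (x y s - x0)"
      by (intro lipschitz_on_normD[OF lip]) auto
    also have "L * norm (x y s - x0) \<le> L * (exp (K * s) * norm y)"
      using norm_bounded[of y s] L by (auto simp: x_def intro!: mult_left_mono)
    also have "norm (f x0) \<le> norm (f x0) * exp (K * s)"
      using s K by (simp add: mult_le_cancel_left1)
    finally show "norm (f (x y s)) \<le> (norm (f x0) + L * norm y) * exp (K * s)"
      by (simp add: algebra_simps)
  qed (use K L in \<open>auto intro!: contf\<close>)
  have \<Phi>_cont: "continuous_on UNIV (\<Phi> y)" for y
  proof -
    have "continuous_on {0..} (\<lambda>u. integral {0..u} (\<lambda>s. f (x y s)))"
      using deriv by (auto simp: continuous_on_eq_continuous_within intro: has_vector_derivative_continuous)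
    then have "continuous_on UNIV (\<lambda>t. integral {0..max 0 t} (\<lambda>s. f (x y s)))"
      by (rule continuous_on_compose2) (auto intro!: continuous_intros)
    then show ?thesis
      unfolding \<Phi>_def by (intro continuous_intros)
  qed
  \<comment> \<open>Continuity and boundedness of \<open>\<Phi> y\<close> let it be lifted to the
    complete space of bounded continuous functions, where Banach's theorem applies.\<close>
  define B where "B y = Bcontfun (\<Phi> y)" for y
  have B: "apply_bcontfun (B y) = \<Phi> y" for y
    unfolding B_def by (intro Bcontfun_inverse bcontfun_normI[OF \<Phi>_cont \<Phi>_bound])
  have "\<exists>!y. B y = y"
  proof (rule banach_fix_type)
    show "0 \<le> L / K" "L / K < 1"
      using L by (auto simp: K_def)
    show "\<forall>y z. dist (B y) (B z) \<le> L / K * dist y z"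
      using \<Phi>_diff by (auto intro!: dist_bound simp: B dist_norm[where 'a = 'a])
  qed
  then obtain y where "B y = y"
    by blast
  then have y: "apply_bcontfun y t = \<Phi> y t" for t
    by (metis B)
  have x: "x y t = x0 + integral {0..t} (\<lambda>s. f (x y s))" if "0 \<le> t" for t
    using that by (subst x_def) (simp add: y \<Phi>_def exp_minus)
  have "(x y has_vector_derivative f (x y t)) (at t within {0..})" if "0 \<le> t" for t
  proof (rule has_vector_derivative_transform)
    show "((\<lambda>u. x0 + integral {0..u} (\<lambda>s. f (x y s))) has_vector_derivative f (x y t)) (at t within {0..})"
      using has_vector_derivative_add[OF has_vector_derivative_const deriv[OF that]] by simp
  qed (use that x in auto)
  then show ?thesis
    using x[of 0] by (auto simp: trajectory_def)
qed

section \<open>Contraction from a one-sided estimate\<close>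

text \<open>Along two trajectories the squared distance weighted by \<open>exp (2 * c * s)\<close>
  has nonpositive derivative, so it never exceeds its initial value.\<close>

lemma contracting_if_dissipative:
  fixes f :: "'a::real_inner \<Rightarrow> 'a"
  assumes "c > 0" and diss: "\<And>x y. (x - y) \<bullet> (f x - f y) \<le> - c * (norm (x - y))\<^sup>2"
  shows "contracting f c"
  unfolding contracting_def
proof (intro conjI allI impI)
  fix x y :: "real \<Rightarrow> 'a" and t :: real
  assume x: "trajectory f x" and y: "trajectory f y" and t: "0 \<le> t"
  define d where "d s = x s - y s" for s
  define \<phi> where "\<phi> s = exp (2 * c * s) * (d s \<bullet> d s)" for s
  have deriv: "(\<phi> has_real_derivative
      2 * exp (2 * c * s) * (c * (norm (d s))\<^sup>2 + d s \<bullet> (f (x s) - f (y s)))) (at s within {0..})"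
    if "0 \<le> s" for s
  proof -
    have "(d has_vector_derivative f (x s) - f (y s)) (at s within {0..})"
      using x y that unfolding d_def trajectory_def by (intro has_vector_derivative_diff) auto
    then have d: "(d has_derivative (\<lambda>h. h *\<^sub>R (f (x s) - f (y s)))) (at s within {0..})"
      by (simp add: has_vector_derivative_def)
    have "((\<lambda>s. d s \<bullet> d s) has_derivative (\<lambda>h. d s \<bullet> (h *\<^sub>R (f (x s) - f (y s))) + (h *\<^sub>R (f (x s) - f (y s))) \<bullet> d s))
        (at s within {0..})"
      by (rule has_derivative_inner[OF d d])
    then have "((\<lambda>s. d s \<bullet> d s) has_real_derivative 2 * (d s \<bullet> (f (x s) - f (y s)))) (at s within {0..})"
      unfolding has_field_derivative_def
      by (rule has_derivative_eq_rhs) (auto simp: fun_eq_iff inner_commute algebra_simps)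
    moreover have "((\<lambda>s. exp (2 * c * s)) has_real_derivative 2 * c * exp (2 * c * s)) (at s within {0..})"
      by (auto intro!: derivative_eq_intros)
    ultimately show ?thesis
      unfolding \<phi>_def
      by (intro DERIV_cong[OF DERIV_mult]) (auto simp: power2_norm_eq_inner algebra_simps)
  qed
  have "\<phi> t \<le> \<phi> 0"
  proof (rule DERIV_nonpos_imp_decreasing_open[OF t])
    have "continuous_on {0..} \<phi>"
      unfolding continuous_on_eq_continuous_within using deriv DERIV_continuous by fastforce
    then show "continuous_on {0..t} \<phi>"
      by (rule continuous_on_subset) auto
    fix s :: real
    \<comment> \<open>The monotonicity criterion wants a two-sided derivative, obtained here at
      interior times; continuity covers the endpoints.\<close>
    assume s: "0 < s" "s < t"
    then have "at s within {0..} = at s"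
      by (intro at_within_interior) (simp add: interior_real_atLeast)
    moreover have "c * (norm (d s))\<^sup>2 + d s \<bullet> (f (x s) - f (y s)) \<le> 0"
      using diss[of "x s" "y s"] by (simp add: d_def)
    ultimately show "\<exists>D. (\<phi> has_real_derivative D) (at s) \<and> D \<le> 0"
      using deriv[of s] s by (fastforce simp: mult_le_0_iff)
  qed
  then have "(exp (c * t) * norm (d t))\<^sup>2 \<le> (norm (d 0))\<^sup>2"
    by (simp add: \<phi>_def power_mult_distrib power2_norm_eq_inner flip: exp_double mult.assoc)
  then have "exp (c * t) * norm (d t) \<le> norm (d 0)"
    by (rule power2_le_imp_le) simp
  then show "norm (x t - y t) \<le> exp (- c * t) * norm (x 0 - y 0)"
    by (simp add: d_def exp_minus field_simps)
qed (rule assms)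

section \<open>The projected field and its equilibria\<close>

lemma projected_field_dissipative:
  fixes F :: "'a::euclidean_space \<Rightarrow> 'a"
  assumes S: "convex S" "closed S" "S \<noteq> {}" and "\<alpha> > 0"
    and mono: "strongly_monotone \<mu> F" and lip: "L-lipschitz_on UNIV F"
  defines "f \<equiv> \<lambda>x. \<alpha> *\<^sub>R (closest_point S (x - F x /\<^sub>R \<alpha>) - x)"
  shows "(x - y) \<bullet> (f x - f y) \<le> - (\<mu> - L\<^sup>2 / (4 * \<alpha>)) * (norm (x - y))\<^sup>2"
proof -
  define u v where "u = x - y" and "v = F x - F y"
  define d where "d = closest_point S (x - F x /\<^sub>R \<alpha>) - closest_point S (y - F y /\<^sub>R \<alpha>)"
  have "(norm d)\<^sup>2 \<le> d \<bullet> (u - v /\<^sub>R \<alpha>)"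
    using closest_point_firmly_nonexpansive[OF S, of "x - F x /\<^sub>R \<alpha>" "y - F y /\<^sub>R \<alpha>"]
    by (simp add: d_def u_def v_def algebra_simps)
  then have firm: "\<alpha> * (d \<bullet> d) \<le> \<alpha> * (d \<bullet> u) - d \<bullet> v"
    using \<open>\<alpha> > 0\<close> by (simp add: power2_norm_eq_inner inner_diff_right field_simps)
  \<comment> \<open>Completing the square: \<open>0 \<le> \<alpha> * (norm (d - u + v /\<^sub>R (2 * \<alpha>)))\<^sup>2\<close> turns the lower bound
    on \<open>d \<bullet> u\<close> given by firm nonexpansiveness into the required upper bound.\<close>
  define w where "w = v /\<^sub>R (2 * \<alpha>)"
  have "0 \<le> \<alpha> * ((d - u + w) \<bullet> (d - u + w))"
    using \<open>\<alpha> > 0\<close> by simp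
  moreover have "v = (2 * \<alpha>) *\<^sub>R w"
    using \<open>\<alpha> > 0\<close> by (simp add: w_def)
  ultimately have "0 \<le> \<alpha> * (d \<bullet> d) - 2 * \<alpha> * (u \<bullet> d) + \<alpha> * (u \<bullet> u) + d \<bullet> v - u \<bullet> v + v \<bullet> v / (4 * \<alpha>)"
    using \<open>\<alpha> > 0\<close> by (simp add: inner_commute algebra_simps)
  \<comment> \<open>By \<open>firm\<close>, the terms
    \<open>\<alpha> * (d \<bullet> d) + d \<bullet> v\<close> are at most
    \<open>\<alpha> * (d \<bullet> u)\<close>, which cancels half of the cross term.\<close>
  with firm have "\<alpha> * (u \<bullet> d) - \<alpha> * (u \<bullet> u) \<le> - (u \<bullet> v) + v \<bullet> v / (4 * \<alpha>)"
    by (simp add: inner_commute)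
  also have "\<dots> \<le> - (\<mu> * (norm u)\<^sup>2) + (L * norm u)\<^sup>2 / (4 * \<alpha>)"
  proof (intro add_mono)
    show "- (u \<bullet> v) \<le> - (\<mu> * (norm u)\<^sup>2)"
      using mono by (simp add: strongly_monotone_def u_def v_def)
    have "(norm v)\<^sup>2 \<le> (L * norm u)\<^sup>2"
      unfolding u_def v_def by (intro power_mono lipschitz_on_normD[OF lip]) auto
    then show "v \<bullet> v / (4 * \<alpha>) \<le> (L * norm u)\<^sup>2 / (4 * \<alpha>)"
      using \<open>\<alpha> > 0\<close> by (simp add: power2_norm_eq_inner divide_right_mono)
  qed
  moreover have "f x - f y = \<alpha> *\<^sub>R (d - u)"
    by (simp add: f_def d_def u_def algebra_simps)
  then have "(x - y) \<bullet> (f x - f y) = \<alpha> * (u \<bullet> d) - \<alpha> * (u \<bullet> u)"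
    by (simp add: u_def[symmetric] inner_diff_right right_diff_distrib)
  ultimately show ?thesis
    by (simp add: u_def[symmetric] power_mult_distrib left_diff_distrib)
qed

text \<open>Serves the existence of trajectories, for which any finite constant will do.\<close>

lemma projected_field_lipschitz:
  fixes F :: "'a::euclidean_space \<Rightarrow> 'a"
  assumes S: "convex S" "closed S" "S \<noteq> {}" and lip: "L-lipschitz_on UNIV F"
  obtains M where "M-lipschitz_on UNIV (\<lambda>x. \<alpha> *\<^sub>R (closest_point S (x - F x /\<^sub>R \<alpha>) - x))"
proof -
  have "1-lipschitz_on T (closest_point S)" for T
    using closest_point_lipschitz[OF S] by (intro lipschitz_onI) auto
  moreover have id: "1-lipschitz_on UNIV (\<lambda>x::'a. x)"
    by (intro lipschitz_onI) auto
  ultimately have "(1 * (1 + \<bar>inverse \<alpha>\<bar> * L))-lipschitz_on UNIV (\<lambda>x. closest_point S (x - F x /\<^sub>R \<alpha>))"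
    using lip by (intro lipschitz_on_compose2[where g = "closest_point S"] lipschitz_on_diff lipschitz_on_cmult)
  from lipschitz_on_cmult[OF lipschitz_on_diff[OF this id]] show thesis
    by (rule that)
qed

text \<open>The variational inequality makes the cross term nonnegative when the squared distance
  from \<open>xs - F xs /\<^sub>R \<alpha>\<close> to a point \<open>z\<close> of \<open>S\<close>
  is expanded around \<open>xs\<close>.\<close>

lemma SOL_closest_point_fixed:
  fixes F :: "'a::euclidean_space \<Rightarrow> 'a"
  assumes S: "convex S" "closed S" and "\<alpha> > 0" and "xs \<in> SOL F S"
  shows "closest_point S (xs - F xs /\<^sub>R \<alpha>) = xs"
proof (rule sym, rule closest_point_unique[OF S])
  show xs: "xs \<in> S"
    using assms by (simp add: SOL_def)
  show "\<forall>z\<in>S. dist (xs - F xs /\<^sub>R \<alpha>) xs \<le> dist (xs - F xs /\<^sub>R \<alpha>) z"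
  proof
    fix z
    assume "z \<in> S"
    then have "0 \<le> (z - xs) \<bullet> F xs"
      using assms by (simp add: SOL_def)
    then have "0 \<le> (F xs /\<^sub>R \<alpha>) \<bullet> (z - xs)"
      using \<open>\<alpha> > 0\<close> by (simp add: inner_commute)
    moreover have "(norm (F xs /\<^sub>R \<alpha> + (z - xs)))\<^sup>2
        = (norm (F xs /\<^sub>R \<alpha>))\<^sup>2 + 2 * ((F xs /\<^sub>R \<alpha>) \<bullet> (z - xs)) + (norm (z - xs))\<^sup>2"
      by (simp only: power2_norm_eq_inner inner_add_left inner_add_right inner_commute)
    ultimately have "(norm (F xs /\<^sub>R \<alpha>))\<^sup>2 \<le> (norm (F xs /\<^sub>R \<alpha> + (z - xs)))\<^sup>2"
      by simp
    then have "norm (F xs /\<^sub>R \<alpha>) \<le> norm (F xs /\<^sub>R \<alpha> + (z - xs))"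
      by (rule power2_le_imp_le) simp
    moreover have "dist (xs - F xs /\<^sub>R \<alpha>) z = norm (- (F xs /\<^sub>R \<alpha> + (z - xs)))"
      by (simp add: dist_norm algebra_simps)
    moreover have "dist (xs - F xs /\<^sub>R \<alpha>) xs = norm (- (F xs /\<^sub>R \<alpha>))"
      by (simp only: dist_norm) (simp del: norm_scaleR)
    ultimately show "dist (xs - F xs /\<^sub>R \<alpha>) xs \<le> dist (xs - F xs /\<^sub>R \<alpha>) z"
      by (simp only: norm_minus_cancel)
  qed
qed

text \<open>Testing each solution against the other and adding contradicts strong monotonicity
  unless they coincide.\<close>

lemma SOL_unique:
  assumes "\<mu> > 0" "strongly_monotone \<mu> F" "x \<in> SOL F S" "y \<in> SOL F S"
  shows "x = y"
proof -
  have "0 \<le> (y - x) \<bullet> F x" "0 \<le> (x - y) \<bullet> F y"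
    using assms by (auto simp: SOL_def)
  then have "(x - y) \<bullet> (F x - F y) \<le> 0"
    by (simp add: inner_diff_left inner_diff_right)
  moreover have "\<mu> * (norm (x - y))\<^sup>2 \<le> (x - y) \<bullet> (F x - F y)"
    using assms by (simp add: strongly_monotone_def)
  ultimately have "\<mu> * (norm (x - y))\<^sup>2 \<le> 0"
    by simp
  then show ?thesis
    using \<open>\<mu> > 0\<close> by (simp add: mult_le_0_iff)
qed

text \<open>Compare with the constant trajectory at \<open>xs\<close>: contraction gives the
  estimate with \<open>M = 1\<close>, and the Lipschitz bound supplies forward completeness.\<close>

lemma globally_exponentially_stable_if_contracting:
  fixes f :: "'a::banach \<Rightarrow> 'a"
  assumes "contracting f c" "f xs = 0" "L-lipschitz_on UNIV f"
  shows "globally_exponentially_stable f xs"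
proof -
  have "trajectory f (\<lambda>_. xs)"
    using assms by (simp add: trajectory_def)
  then have "norm (x t - xs) \<le> 1 * exp (- c * t) * norm (x 0 - xs)"
    if "trajectory f x" "0 \<le> t" for x t
    using assms(1) that unfolding contracting_def by fastforce
  moreover have "c > 0"
    using assms(1) by (simp add: contracting_def)
  ultimately have "\<exists>M>0. \<exists>r>0. \<forall>x. trajectory f x \<longrightarrow>
      (\<forall>t\<ge>0. norm (x t - xs) \<le> M * exp (- r * t) * norm (x 0 - xs))"
    by (intro exI[of _ 1] exI[of _ c] conjI allI impI) auto
  with assms show ?thesis
    by (auto simp: globally_exponentially_stable_def lipschitz_trajectory_exists)
qed

section \<open>Polyhedral constraints and the safe monotone flow\<close>

lemma convex_polyhedral_set: "convex (polyhedral_set G cg H ch)"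
  and closed_polyhedral_set: "closed (polyhedral_set G cg H ch)"
proof -
  have eq: "polyhedral_set G cg H ch = (*v) G -` {v. v \<le> cg} \<inter> (*v) H -` {ch}"
    by (auto simp: polyhedral_set_def)
  have "convex {v. v \<le> cg}"
    by (auto simp: convex_def less_eq_vec_def intro!: convex_bound_le)
  then show "convex (polyhedral_set G cg H ch)"
    unfolding eq
    by (intro convex_Int convex_linear_vimage matrix_vector_mul_linear convex_singleton)
  have "closed {v. v \<le> cg}"
    unfolding less_eq_vec_def
    by (intro closed_Collect_all closed_Collect_le continuous_intros)
  then show "closed (polyhedral_set G cg H ch)"
    unfolding eq
    by (intro closed_Int continuous_closed_vimage closed_singleton linear_continuous_at
        matrix_vector_mul_bounded_linear)
qed

text \<open>Substitute \<open>\<xi> = \<alpha> *\<^sub>R (z - x)\<close>: the terms in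
  \<open>x\<close> cancel, and dividing by \<alpha> leaves the constraints on
  \<open>z\<close>.\<close>

lemma restricted_tangent_set_eq:
  assumes "\<alpha> > 0"
  shows "restricted_tangent_set \<alpha> G cg H ch x = (\<lambda>z. \<alpha> *\<^sub>R (z - x)) ` polyhedral_set G cg H ch"
proof (intro equalityI subsetI)
  fix \<xi>
  assume \<xi>: "\<xi> \<in> restricted_tangent_set \<alpha> G cg H ch x"
  have "x + \<xi> /\<^sub>R \<alpha> \<in> polyhedral_set G cg H ch"
    using \<xi> \<open>\<alpha> > 0\<close>
    by (auto simp: restricted_tangent_set_def polyhedral_set_def less_eq_vec_def vec_eq_iff
        matrix_vector_right_distrib matrix_vector_mult_scaleR field_simps)
  moreover have "\<xi> = \<alpha> *\<^sub>R (x + \<xi> /\<^sub>R \<alpha> - x)"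
    using \<open>\<alpha> > 0\<close> by simp
  ultimately show "\<xi> \<in> (\<lambda>z. \<alpha> *\<^sub>R (z - x)) ` polyhedral_set G cg H ch"
    by blast
next
  fix \<xi>
  assume "\<xi> \<in> (\<lambda>z. \<alpha> *\<^sub>R (z - x)) ` polyhedral_set G cg H ch"
  then show "\<xi> \<in> restricted_tangent_set \<alpha> G cg H ch x"
    using \<open>\<alpha> > 0\<close>
    by (auto simp: restricted_tangent_set_def polyhedral_set_def less_eq_vec_def vec_eq_iff
        matrix_vector_mult_diff_distrib matrix_vector_mult_scaleR algebra_simps)
qed

text \<open>A nonempty polyhedron makes every restricted tangent set nonempty, so
  \<open>closest_point\<close> is a genuine projection and not an unspecified value.\<close>

lemma safe_monotone_field_eq:
  assumes "\<alpha> > 0" "polyhedral_set G cg H ch \<noteq> {}"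
  shows "safe_monotone_field F \<alpha> G cg H ch
    = (\<lambda>x. \<alpha> *\<^sub>R (closest_point (polyhedral_set G cg H ch) (x - F x /\<^sub>R \<alpha>) - x))"
  using closest_point_affinity[OF convex_polyhedral_set closed_polyhedral_set assms(2,1)]
  by (simp add: fun_eq_iff safe_monotone_field_def restricted_tangent_set_eq[OF assms(1)])

theorem theorem5p13:
  fixes F :: "real^'n \<Rightarrow> real^'n"
    and G :: "real^'n^'m" and cg :: "real^'m"
    and H :: "real^'n^'k" and ch :: "real^'k"
    and \<mu> lF \<alpha> :: real
  assumes "continuously_differentiable F"
    and "\<mu> > 0"
    and "strongly_monotone \<mu> F"
    and "lF-lipschitz_on UNIV F"
    and "SOL F (polyhedral_set G cg H ch) \<noteq> {}"
    and "\<alpha> > lF\<^sup>2 / (4 * \<mu>)"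
  shows "contracting (safe_monotone_field F \<alpha> G cg H ch) (\<mu> - lF\<^sup>2 / (4 * \<alpha>)) \<and>
    (\<exists>xs. SOL F (polyhedral_set G cg H ch) = {xs} \<and>
       globally_exponentially_stable (safe_monotone_field F \<alpha> G cg H ch) xs)"
proof -
  let ?C = "polyhedral_set G cg H ch" and ?f = "safe_monotone_field F \<alpha> G cg H ch"
  have "0 \<le> lF\<^sup>2 / (4 * \<mu>)"
    using \<open>\<mu> > 0\<close> by simp
  with assms have \<alpha>: "\<alpha> > 0"
    by linarith
  \<comment> \<open>For positive \<mu> and \<alpha>, the threshold on \<alpha> is exactly positivity
    of the rate.\<close>
  have c: "\<mu> - lF\<^sup>2 / (4 * \<alpha>) > 0"
    using \<open>\<mu> > 0\<close> \<alpha> assms(6) by (simp add: field_simps)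
  obtain xs where xs: "xs \<in> SOL F ?C"
    using assms(5) by blast
  then have ne: "?C \<noteq> {}"
    by (auto simp: SOL_def)
  note C = convex_polyhedral_set[of G cg H ch] closed_polyhedral_set[of G cg H ch]
  note f = safe_monotone_field_eq[OF \<alpha> ne, of F]
  have contr: "contracting ?f (\<mu> - lF\<^sup>2 / (4 * \<alpha>))"
    unfolding f
    by (intro contracting_if_dissipative c projected_field_dissipative C ne \<alpha> assms)
  obtain M where "M-lipschitz_on UNIV ?f"
    using projected_field_lipschitz[OF C ne assms(4)] unfolding f by blast
  moreover have "?f xs = 0"
    using SOL_closest_point_fixed[OF C \<alpha> xs] by (simp add: f)
  ultimately have "globally_exponentially_stable ?f xs"
    using contr by (intro globally_exponentially_stable_if_contracting)
  moreover have "SOL F ?C = {xs}"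
    using SOL_unique[OF assms(2,3)] xs by blast
  ultimately show ?thesis
    using contr by blast
qed

end
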